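(* Let $\mathcal{M}=\langle\Sigma,\mathcal{S},s_i,s_f,\delta\rangle$ be a deterministic Turing machine with semi-infinite tape and $x=x_1\cdots x_n$ an input string containing no blank symbol. Let $\mathcal{P}_\mathcal{M}$ be the program consisting of the rule $\mathrm{conf}(s_f,L,V,R).$ together with, for each state $s\in\mathcal{S}\setminus\{s_f\}$ and each symbol $v\in\Sigma$: the rule $\mathrm{conf}(s,[V|L],v,R)\leftarrow\mathrm{conf}(s',L,V,[v'|R])$ if $\delta(s,v)=(s',v',\leftarrow)$; and the two rules $\mathrm{conf}(s,L,v,[V|R])\leftarrow\mathrm{conf}(s',[v'|L],V,R)$ and $\mathrm{conf}(s,L,v,[\,])\leftarrow\mathrm{conf}(s',[v'|L],\sqcup,[\,])$ if $\delta(s,v)=(s',v',\rightarrow)$ (here $L,V,R$ are variables, and states and symbols are constants). Let $\mathcal{Q}_{\mathcal{M}(x)}$ be $\mathrm{conf}(s_i,[\,],x_1,[x_2,\dots,x_n])$ if $n>0$ and $\mathrm{conf}(s_i,[\,],\sqcup,[\,])$ otherwise. Then $\mathcal{P}_\mathcal{M}$ bravely (equivalently, cautiously) entails $\mathcal{Q}_{\mathcal{M}(x)}$ if and only if $\mathcal{M}$ accepts $x$.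
   Context: A Turing machine with semi-infinite tape is $\langle\Sigma,\mathcal{S},s_i,s_f,\delta\rangle$: alphabet $\Sigma$ containing the blank $\sqcup$, state set $\mathcal{S}$, distinct initial and final states $s_i,s_f$, and transition function $\delta:\mathcal{S}\times\Sigma\to\mathcal{S}\times\Sigma\times\{\leftarrow,\rightarrow\}$. Initially the state is $s_i$, the tape holds $x$ followed by infinitely many blanks, and the head is on the first cell; if the current state is $s$, the scanned symbol $v$ and $\delta(s,v)=(s',v',m)$, the machine writes $v'$, moves its head in direction $m$ and enters $s'$. $\mathcal{M}$ accepts $x$ if $s_f$ is reached at some point. Lists are terms built from the constant $[\,]$ and a binary function symbol, $[h|t]$ having head $h$ and tail $t$. A rule $a_1\vee\dots\vee a_n\leftarrow$ body; a program is a finite set of rules; $\mathrm{Ground}(\mathcal{P})$ is the set of ground instances over ground terms built from $\mathcal{P}$'s function symbols; stable models are subset-minimal models $M$ of the reduct $\mathrm{Ground}(\mathcal{P})^M$ (for a negation-free program, its unique minimal model). A query is a ground atom; brave (cautious) entailment means it belongs to some (every) stable model. *)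

theory Defs
  imports Main
begin

datatype ('f, 'v) trm = Var 'v | Fun 'f "('f, 'v) trm list"

datatype ('p, 'f, 'v) atom = Atom (pred: 'p) (args: "('f, 'v) trm list")

text \<open>
  \<open>Rule [a\<^sub>1, \<dots>, a\<^sub>n] [b\<^sub>1, \<dots>, b\<^sub>k] [c\<^sub>1, \<dots>, c\<^sub>m]\<close> stands for
  \<open>a\<^sub>1 \<or> \<dots> \<or> a\<^sub>n \<leftarrow> b\<^sub>1, \<dots>, b\<^sub>k, not c\<^sub>1, \<dots>, not c\<^sub>m\<close>.
\<close>

datatype ('p, 'f, 'v) asp_rule =
  Rule (head: "('p, 'f, 'v) atom list")
       (pos_body: "('p, 'f, 'v) atom list")
       (neg_body: "('p, 'f, 'v) atom list")

type_synonym ('p, 'f, 'v) program = "('p, 'f, 'v) asp_rule set"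

definition rule_atoms :: "('p, 'f, 'v) asp_rule \<Rightarrow> ('p, 'f, 'v) atom set" where
  "rule_atoms r = set (head r) \<union> set (pos_body r) \<union> set (neg_body r)"

definition program_atoms :: "('p, 'f, 'v) program \<Rightarrow> ('p, 'f, 'v) atom set" where
  "program_atoms P = (\<Union>r\<in>P. rule_atoms r)"

primrec trm_vars :: "('f, 'v) trm \<Rightarrow> 'v set" where
  "trm_vars (Var x) = {x}"
| "trm_vars (Fun f ts) = \<Union> (set (map trm_vars ts))"

definition rule_vars :: "('p, 'f, 'v) asp_rule \<Rightarrow> 'v set" where
  "rule_vars r = (\<Union>a\<in>rule_atoms r. \<Union>t\<in>set (args a). trm_vars t)"

text \<open>A function symbol is a name together with the arity at which it occurs; constants have arity 0.\<close>

primrec trm_funs :: "('f, 'v) trm \<Rightarrow> ('f \<times> nat) set" where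
  "trm_funs (Var x) = {}"
| "trm_funs (Fun f ts) = insert (f, length ts) (\<Union> (set (map trm_funs ts)))"

definition program_funs :: "('p, 'f, 'v) program \<Rightarrow> ('f \<times> nat) set" where
  "program_funs P = (\<Union>a\<in>program_atoms P. \<Union>t\<in>set (args a). trm_funs t)"

definition program_preds :: "('p, 'f, 'v) program \<Rightarrow> ('p \<times> nat) set" where
  "program_preds P = (\<lambda>a. (pred a, length (args a))) ` program_atoms P"

inductive_set ground_terms :: "('f \<times> nat) set \<Rightarrow> ('f, 'v) trm set"
  for F :: "('f \<times> nat) set" where
  "(f, length ts) \<in> F \<Longrightarrow> (\<And>t. t \<in> set ts \<Longrightarrow> t \<in> ground_terms F)
    \<Longrightarrow> Fun f ts \<in> ground_terms F"

definition herbrand_universe :: "('p, 'f, 'v) program \<Rightarrow> ('f, 'v) trm set" where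
  "herbrand_universe P = ground_terms (program_funs P)"

definition herbrand_base :: "('p, 'f, 'v) program \<Rightarrow> ('p, 'f, 'v) atom set" where
  "herbrand_base P =
    {Atom p ts | p ts. (p, length ts) \<in> program_preds P \<and> set ts \<subseteq> herbrand_universe P}"

primrec subst_trm :: "('v \<Rightarrow> ('f, 'v) trm) \<Rightarrow> ('f, 'v) trm \<Rightarrow> ('f, 'v) trm" where
  "subst_trm \<sigma> (Var x) = \<sigma> x"
| "subst_trm \<sigma> (Fun f ts) = Fun f (map (subst_trm \<sigma>) ts)"

definition subst_atom ::
  "('v \<Rightarrow> ('f, 'v) trm) \<Rightarrow> ('p, 'f, 'v) atom \<Rightarrow> ('p, 'f, 'v) atom" where
  "subst_atom \<sigma> a = Atom (pred a) (map (subst_trm \<sigma>) (args a))"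

definition subst_rule ::
  "('v \<Rightarrow> ('f, 'v) trm) \<Rightarrow> ('p, 'f, 'v) asp_rule \<Rightarrow> ('p, 'f, 'v) asp_rule" where
  "subst_rule \<sigma> r = Rule (map (subst_atom \<sigma>) (head r))
     (map (subst_atom \<sigma>) (pos_body r)) (map (subst_atom \<sigma>) (neg_body r))"

definition Ground :: "('p, 'f, 'v) program \<Rightarrow> ('p, 'f, 'v) program" where
  "Ground P = {subst_rule \<sigma> r | \<sigma> r. r \<in> P \<and> (\<forall>x\<in>rule_vars r. \<sigma> x \<in> herbrand_universe P)}"

definition satisfies_rule :: "('p, 'f, 'v) atom set \<Rightarrow> ('p, 'f, 'v) asp_rule \<Rightarrow> bool" where
  "satisfies_rule I r \<longleftrightarrow>
    (set (pos_body r) \<subseteq> I \<and> set (neg_body r) \<inter> I = {} \<longrightarrow> set (head r) \<inter> I \<noteq> {})"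

text \<open>Satisfaction of ground programs; instances must be taken beforehand by \<open>Ground\<close>.\<close>

definition is_model :: "('p, 'f, 'v) atom set \<Rightarrow> ('p, 'f, 'v) program \<Rightarrow> bool" where
  "is_model I G \<longleftrightarrow> (\<forall>r\<in>G. satisfies_rule I r)"

text \<open>The Gelfond--Lifschitz reduct of a ground program.\<close>

definition reduct ::
  "('p, 'f, 'v) program \<Rightarrow> ('p, 'f, 'v) atom set \<Rightarrow> ('p, 'f, 'v) program" where
  "reduct G I = {Rule (head r) (pos_body r) [] | r. r \<in> G \<and> set (neg_body r) \<inter> I = {}}"

definition stable_model :: "('p, 'f, 'v) program \<Rightarrow> ('p, 'f, 'v) atom set \<Rightarrow> bool" where
  "stable_model P I \<longleftrightarrow> I \<subseteq> herbrand_base P \<and> is_model I (reduct (Ground P) I) \<and>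
    (\<forall>J. J \<subset> I \<longrightarrow> \<not> is_model J (reduct (Ground P) I))"

definition bravely_entails :: "('p, 'f, 'v) program \<Rightarrow> ('p, 'f, 'v) atom \<Rightarrow> bool" where
  "bravely_entails P q \<longleftrightarrow> (\<exists>I. stable_model P I \<and> q \<in> I)"

definition cautiously_entails :: "('p, 'f, 'v) program \<Rightarrow> ('p, 'f, 'v) atom \<Rightarrow> bool" where
  "cautiously_entails P q \<longleftrightarrow> (\<forall>I. stable_model P I \<longrightarrow> q \<in> I)"

datatype move = MoveLeft | MoveRight

record ('s, 'a) tm =
  alphabet :: "'a set"
  blank :: 'a
  states :: "'s set"
  init :: 's
  final :: 's
  delta :: "'s \<Rightarrow> 'a \<Rightarrow> 's \<times> 'a \<times> move"

definition turing_machine :: "('s, 'a) tm \<Rightarrow> bool" where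
  "turing_machine M \<longleftrightarrow>
     finite (alphabet M) \<and> blank M \<in> alphabet M \<and>
     finite (states M) \<and> init M \<in> states M \<and> final M \<in> states M \<and> init M \<noteq> final M \<and>
     (\<forall>s\<in>states M. \<forall>v\<in>alphabet M. delta M s v \<in> states M \<times> alphabet M \<times> UNIV)"

text \<open>Current state, tape contents, and head position; the first cell has index 0.\<close>

type_synonym ('s, 'a) config = "'s \<times> (nat \<Rightarrow> 'a) \<times> nat"

definition initial_config :: "('s, 'a) tm \<Rightarrow> 'a list \<Rightarrow> ('s, 'a) config" where
  "initial_config M x = (init M, (\<lambda>i. if i < length x then x ! i else blank M), 0)"

text \<open>
  There is no cell to the left of the first one: a configuration that calls for a left move
  there has no successor.
\<close>

inductive tm_step :: "('s, 'a) tm \<Rightarrow> ('s, 'a) config \<Rightarrow> ('s, 'a) config \<Rightarrow> bool"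
  for M :: "('s, 'a) tm" where
  move_right: "delta M s (T h) = (s', v', MoveRight)
    \<Longrightarrow> tm_step M (s, T, h) (s', T(h := v'), Suc h)"
| move_left: "delta M s (T (Suc h)) = (s', v', MoveLeft)
    \<Longrightarrow> tm_step M (s, T, Suc h) (s', T(Suc h := v'), h)"

definition accepts :: "('s, 'a) tm \<Rightarrow> 'a list \<Rightarrow> bool" where
  "accepts M x \<longleftrightarrow> (\<exists>T h. (tm_step M)\<^sup>*\<^sup>* (initial_config M x) (final M, T, h))"

datatype ('s, 'a) tm_fun = NilSym | ConsSym | StateConst 's | SymbolConst 'a

datatype tm_pred = Conf

datatype tm_var = VarL | VarV | VarR

type_synonym ('s, 'a) tm_trm = "(('s, 'a) tm_fun, tm_var) trm"
type_synonym ('s, 'a) tm_atom = "(tm_pred, ('s, 'a) tm_fun, tm_var) atom"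
type_synonym ('s, 'a) tm_rule = "(tm_pred, ('s, 'a) tm_fun, tm_var) asp_rule"

abbreviation nil_trm :: "('s, 'a) tm_trm" where
  "nil_trm \<equiv> Fun NilSym []"

abbreviation cons_trm :: "('s, 'a) tm_trm \<Rightarrow> ('s, 'a) tm_trm \<Rightarrow> ('s, 'a) tm_trm" where
  "cons_trm h t \<equiv> Fun ConsSym [h, t]"

abbreviation state_trm :: "'s \<Rightarrow> ('s, 'a) tm_trm" where
  "state_trm s \<equiv> Fun (StateConst s) []"

abbreviation symbol_trm :: "'a \<Rightarrow> ('s, 'a) tm_trm" where
  "symbol_trm v \<equiv> Fun (SymbolConst v) []"

definition list_trm :: "('s, 'a) tm_trm list \<Rightarrow> ('s, 'a) tm_trm" where
  "list_trm ts = foldr cons_trm ts nil_trm"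

definition conf ::
  "'s \<Rightarrow> ('s, 'a) tm_trm \<Rightarrow> ('s, 'a) tm_trm \<Rightarrow> ('s, 'a) tm_trm \<Rightarrow> ('s, 'a) tm_atom" where
  "conf s l v r = Atom Conf [state_trm s, l, v, r]"

definition transition_rules :: "('s, 'a) tm \<Rightarrow> 's \<Rightarrow> 'a \<Rightarrow> ('s, 'a) tm_rule set" where
  "transition_rules M s v =
    (case delta M s v of
      (s', v', MoveLeft) \<Rightarrow>
        {Rule [conf s (cons_trm (Var VarV) (Var VarL)) (symbol_trm v) (Var VarR)]
              [conf s' (Var VarL) (Var VarV) (cons_trm (symbol_trm v') (Var VarR))] []}
    | (s', v', MoveRight) \<Rightarrow>
        {Rule [conf s (Var VarL) (symbol_trm v) (cons_trm (Var VarV) (Var VarR))]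
              [conf s' (cons_trm (symbol_trm v') (Var VarL)) (Var VarV) (Var VarR)] [],
         Rule [conf s (Var VarL) (symbol_trm v) nil_trm]
              [conf s' (cons_trm (symbol_trm v') (Var VarL)) (symbol_trm (blank M)) nil_trm] []})"

definition tm_program ::
  "('s, 'a) tm \<Rightarrow> (tm_pred, ('s, 'a) tm_fun, tm_var) program" where
  "tm_program M =
    insert (Rule [conf (final M) (Var VarL) (Var VarV) (Var VarR)] [] [])
      (\<Union>s\<in>states M - {final M}. \<Union>v\<in>alphabet M. transition_rules M s v)"

lemma finite_tm_program:
  assumes "turing_machine M"
  shows "finite (tm_program M)"
proof -
  have "finite (transition_rules M s v)" for s v
    by (auto simp: transition_rules_def split: prod.split move.split)
  then show ?thesis
    using assms by (simp add: tm_program_def turing_machine_def)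
qed

definition tm_query :: "('s, 'a) tm \<Rightarrow> 'a list \<Rightarrow> ('s, 'a) tm_atom" where
  "tm_query M x =
    (case x of
      [] \<Rightarrow> conf (init M) nil_trm (symbol_trm (blank M)) nil_trm
    | x1 # xs \<Rightarrow> conf (init M) nil_trm (symbol_trm x1) (list_trm (map symbol_trm xs)))"

end

theory Submission
  imports Defs
begin

text \<open>
  The program is definite, so its only stable model is the least model of its ground instances.
  An atom describes a configuration by the cells left of the head (reversed), the scanned cell, and
  the cells right of the head up to some bound beyond which the tape is blank. Each rule undoes one
  machine step, so the derivable atoms of this shape are exactly the configurations from which the
  final state is reachable. The empty list belongs to the Herbrand universe only if some
  transition moves right; an accepting run provides one, since its first step cannot move left.
\<close>

section \<open>Stable models of definite programs\<close>

text \<open>Forward inference that reads positive bodies and admits every head atom; it yields the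
  least model once all rules are definite.\<close>

inductive_set least_model :: "('p, 'f, 'v) program \<Rightarrow> ('p, 'f, 'v) atom set"
  for G :: "('p, 'f, 'v) program" where
  infer: "r \<in> G \<Longrightarrow> (\<And>b. b \<in> set (pos_body r) \<Longrightarrow> b \<in> least_model G)
    \<Longrightarrow> a \<in> set (head r) \<Longrightarrow> a \<in> least_model G"

definition definite_rule :: "('p, 'f, 'v) asp_rule \<Rightarrow> bool" where
  "definite_rule r \<longleftrightarrow> (\<exists>a. head r = [a]) \<and> neg_body r = []"

lemma definite_rule_subst: "definite_rule r \<Longrightarrow> definite_rule (subst_rule \<sigma> r)"
  by (auto simp: definite_rule_def subst_rule_def)

lemma definite_Ground:
  "(\<And>r. r \<in> P \<Longrightarrow> definite_rule r) \<Longrightarrow> r \<in> Ground P \<Longrightarrow> definite_rule r"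
  by (auto simp: Ground_def definite_rule_subst)

text \<open>An empty negative body never conflicts with \<open>I\<close> and stripping it changes
  nothing, so the reduct does not depend on the candidate model.\<close>

lemma reduct_definite:
  assumes "\<And>r. r \<in> G \<Longrightarrow> definite_rule r"
  shows "reduct G I = G"
proof -
  have "Rule (head r) (pos_body r) [] = r" "set (neg_body r) \<inter> I = {}" if "r \<in> G" for r
    using assms[OF that] by (cases r; simp add: definite_rule_def)+
  then show ?thesis
    unfolding reduct_def by force
qed

lemma least_model_is_model:
  assumes "\<And>r. r \<in> G \<Longrightarrow> definite_rule r"
  shows "is_model (least_model G) G"
  unfolding is_model_def satisfies_rule_def
proof (intro ballI impI)
  fix r
  assume r: "r \<in> G" and "set (pos_body r) \<subseteq> least_model G \<and> set (neg_body r) \<inter> least_model G = {}"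
  moreover obtain a where "head r = [a]"
    using assms[OF r] by (auto simp: definite_rule_def)
  ultimately show "set (head r) \<inter> least_model G \<noteq> {}"
    using infer[of r G a] by auto
qed

text \<open>Rule induction: since the head is a single atom, satisfaction of the rule puts that very
  atom into \<open>I\<close>.\<close>

lemma least_model_subset:
  assumes "\<And>r. r \<in> G \<Longrightarrow> definite_rule r" and "is_model I G"
  shows "least_model G \<subseteq> I"
proof
  fix a
  assume "a \<in> least_model G"
  then show "a \<in> I"
  proof induction
    case (infer r a)
    then show ?case
      using assms(1)[of r] assms(2)
      by (fastforce simp: definite_rule_def is_model_def satisfies_rule_def)
  qed
qed

lemma subst_trm_ground:
  assumes "trm_funs t \<subseteq> F" and "\<And>x. x \<in> trm_vars t \<Longrightarrow> \<sigma> x \<in> ground_terms F"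
  shows "subst_trm \<sigma> t \<in> ground_terms F"
  using assms
proof (induction t)
  case (Fun f ts)
  have "subst_trm \<sigma> t \<in> ground_terms F" if "t \<in> set ts" for t
    using that Fun.prems by (intro Fun.IH) auto
  then show ?case
    using Fun.prems by (auto intro!: ground_terms.intros)
qed simp

lemma subst_atom_herbrand_base:
  assumes r: "r \<in> P" and a: "a \<in> rule_atoms r"
    and \<sigma>: "\<And>x. x \<in> rule_vars r \<Longrightarrow> \<sigma> x \<in> herbrand_universe P"
  shows "subst_atom \<sigma> a \<in> herbrand_base P"
proof -
  have aP: "a \<in> program_atoms P"
    using r a by (auto simp: program_atoms_def)
  then have "(pred a, length (args a)) \<in> program_preds P"
    by (auto simp: program_preds_def)
  moreover have "subst_trm \<sigma> t \<in> herbrand_universe P" if "t \<in> set (args a)" for t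
    unfolding herbrand_universe_def
  proof (rule subst_trm_ground)
    show "trm_funs t \<subseteq> program_funs P"
      using aP that by (auto simp: program_funs_def)
    show "\<sigma> x \<in> ground_terms (program_funs P)" if "x \<in> trm_vars t" for x
      using \<sigma>[of x] that a \<open>t \<in> set (args a)\<close>
      by (auto simp: rule_vars_def herbrand_universe_def)
  qed
  ultimately show ?thesis
    by (auto simp: herbrand_base_def subst_atom_def)
qed

text \<open>Serves the first condition of \<open>stable_model\<close>. The last inference suffices:
  it shows the atom to be an instance of a head in \<open>P\<close>.\<close>

lemma least_model_herbrand_base: "least_model (Ground P) \<subseteq> herbrand_base P"
proof
  fix a
  assume "a \<in> least_model (Ground P)"
  then show "a \<in> herbrand_base P"
  proof cases
    case (infer r)
    then obtain \<sigma> r' where "r = subst_rule \<sigma> r'" "r' \<in> P"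
      "\<And>x. x \<in> rule_vars r' \<Longrightarrow> \<sigma> x \<in> herbrand_universe P"
      by (auto simp: Ground_def)
    then show ?thesis
      using infer(3) by (auto simp: subst_rule_def rule_atoms_def intro!: subst_atom_herbrand_base)
  qed
qed

text \<open>The reduct is \<open>Ground P\<close> for every \<open>I\<close>, so stable models are
  minimal models; the least model lies below all models and is therefore the only minimal
  one.\<close>

theorem stable_model_definite:
  assumes "\<And>r. r \<in> P \<Longrightarrow> definite_rule r"
  shows "stable_model P I \<longleftrightarrow> I = least_model (Ground P)"
proof -
  have def_G: "definite_rule r" if "r \<in> Ground P" for r
    using definite_Ground[OF assms that] .
  have reduct: "reduct (Ground P) I = Ground P"
    using def_G by (rule reduct_definite)
  have model: "is_model (least_model (Ground P)) (Ground P)"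
    using def_G by (rule least_model_is_model)
  have least: "least_model (Ground P) \<subseteq> J" if "is_model J (Ground P)" for J
    using def_G that by (rule least_model_subset)
  show ?thesis
    unfolding stable_model_def reduct
    using model least least_model_herbrand_base[of P] by (metis psubsetI psubset_eq subset_antisym)
qed

lemma entails_definite:
  assumes "\<And>r. r \<in> P \<Longrightarrow> definite_rule r"
  shows "bravely_entails P q \<longleftrightarrow> q \<in> least_model (Ground P)"
    and "cautiously_entails P q \<longleftrightarrow> q \<in> least_model (Ground P)"
  by (simp_all add: bravely_entails_def cautiously_entails_def stable_model_definite[OF assms])

section \<open>Derivations in the Turing machine program\<close>

lemma definite_transition_rules:
  assumes "r \<in> transition_rules M s v"
  shows "definite_rule r"
proof -
  obtain s' v' m where "delta M s v = (s', v', m)"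
    using prod_cases3 .
  with assms show ?thesis
    by (cases m) (auto simp: transition_rules_def definite_rule_def)
qed

lemma definite_tm_program: "r \<in> tm_program M \<Longrightarrow> definite_rule r"
  unfolding tm_program_def using definite_transition_rules by (fastforce simp: definite_rule_def)

abbreviation tm_universe :: "('s, 'a) tm \<Rightarrow> ('s, 'a) tm_trm set" where
  "tm_universe M \<equiv> herbrand_universe (tm_program M)"

abbreviation tm_model :: "('s, 'a) tm \<Rightarrow> ('s, 'a) tm_atom set" where
  "tm_model M \<equiv> least_model (Ground (tm_program M))"

text \<open>There are just three variables, so a triple of terms determines a substitution.\<close>

definition inst :: "('s, 'a) tm_trm \<Rightarrow> ('s, 'a) tm_trm \<Rightarrow> ('s, 'a) tm_trm \<Rightarrow> tm_var \<Rightarrow> ('s, 'a) tm_trm" where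
  "inst l v r x = (case x of VarL \<Rightarrow> l | VarV \<Rightarrow> v | VarR \<Rightarrow> r)"

lemma inst_simps [simp]:
  "inst l v r VarL = l" "inst l v r VarV = v" "inst l v r VarR = r"
  by (simp_all add: inst_def)

lemma subst_atom_conf [simp]:
  "subst_atom \<sigma> (conf s l v r) = conf s (subst_trm \<sigma> l) (subst_trm \<sigma> v) (subst_trm \<sigma> r)"
  by (simp add: conf_def subst_atom_def)

lemma conf_inject [simp]:
  "conf s l v r = conf s' l' v' r' \<longleftrightarrow> s = s' \<and> l = l' \<and> v = v' \<and> r = r'"
  by (simp add: conf_def)

lemma tm_model_derive:
  assumes "Rule [a] bs [] \<in> tm_program M"
    and "l \<in> tm_universe M" "v \<in> tm_universe M" "r \<in> tm_universe M"
    and "\<And>b. b \<in> set bs \<Longrightarrow> subst_atom (inst l v r) b \<in> tm_model M"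
  shows "subst_atom (inst l v r) a \<in> tm_model M"
proof (rule infer)
  have "inst l v r x \<in> tm_universe M" for x
    using assms(2-4) by (cases x) simp_all
  then show "subst_rule (inst l v r) (Rule [a] bs []) \<in> Ground (tm_program M)"
    using assms(1) by (auto simp: Ground_def)
qed (use assms(5) in \<open>auto simp: subst_rule_def\<close>)

lemma tm_model_final:
  assumes "l \<in> tm_universe M" "v \<in> tm_universe M" "r \<in> tm_universe M"
  shows "conf (final M) l v r \<in> tm_model M"
proof -
  have "Rule [conf (final M) (Var VarL) (Var VarV) (Var VarR)] [] [] \<in> tm_program M"
    by (simp add: tm_program_def)
  from tm_model_derive[OF this assms] show ?thesis
    by simp
qed

lemma transition_rules_in_program:
  "s \<in> states M \<Longrightarrow> s \<noteq> final M \<Longrightarrow> v \<in> alphabet M \<Longrightarrow> transition_rules M s v \<subseteq> tm_program M"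
  by (auto simp: tm_program_def)

text \<open>This and the next two lemmas turn the rule shapes into derivation steps; inference runs
  against the machine, from the configuration after a move to the one before it.\<close>

lemma tm_model_left:
  assumes "s \<in> states M" "s \<noteq> final M" "a \<in> alphabet M" "delta M s a = (s', a', MoveLeft)"
    and "l \<in> tm_universe M" "v \<in> tm_universe M" "r \<in> tm_universe M"
    and "conf s' l v (cons_trm (symbol_trm a') r) \<in> tm_model M"
  shows "conf s (cons_trm v l) (symbol_trm a) r \<in> tm_model M"
proof -
  have "Rule [conf s (cons_trm (Var VarV) (Var VarL)) (symbol_trm a) (Var VarR)]
      [conf s' (Var VarL) (Var VarV) (cons_trm (symbol_trm a') (Var VarR))] [] \<in> tm_program M"
    using transition_rules_in_program[OF assms(1-3)] by (simp add: transition_rules_def assms(4))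
  from tm_model_derive[OF this assms(5-7)] show ?thesis
    using assms(8) by simp
qed

lemma tm_model_right:
  assumes "s \<in> states M" "s \<noteq> final M" "a \<in> alphabet M" "delta M s a = (s', a', MoveRight)"
    and "l \<in> tm_universe M" "v \<in> tm_universe M" "r \<in> tm_universe M"
    and "conf s' (cons_trm (symbol_trm a') l) v r \<in> tm_model M"
  shows "conf s l (symbol_trm a) (cons_trm v r) \<in> tm_model M"
proof -
  have "Rule [conf s (Var VarL) (symbol_trm a) (cons_trm (Var VarV) (Var VarR))]
      [conf s' (cons_trm (symbol_trm a') (Var VarL)) (Var VarV) (Var VarR)] [] \<in> tm_program M"
    using transition_rules_in_program[OF assms(1-3)] by (simp add: transition_rules_def assms(4))
  from tm_model_derive[OF this assms(5-7)] show ?thesis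
    using assms(8) by simp
qed

lemma tm_model_right_end:
  assumes "s \<in> states M" "s \<noteq> final M" "a \<in> alphabet M" "delta M s a = (s', a', MoveRight)"
    and "l \<in> tm_universe M"
    and "conf s' (cons_trm (symbol_trm a') l) (symbol_trm (blank M)) nil_trm \<in> tm_model M"
  shows "conf s l (symbol_trm a) nil_trm \<in> tm_model M"
proof -
  have "Rule [conf s (Var VarL) (symbol_trm a) nil_trm]
      [conf s' (cons_trm (symbol_trm a') (Var VarL)) (symbol_trm (blank M)) nil_trm] [] \<in> tm_program M"
    using transition_rules_in_program[OF assms(1-3)] by (simp add: transition_rules_def assms(4))
  \<comment> \<open>\<open>VarL\<close> is the only variable of this rule; \<open>l\<close> also
    serves as an arbitrary ground value for \<open>VarV\<close> and \<open>VarR\<close>.\<close>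
  from tm_model_derive[OF this assms(5) assms(5) assms(5)] show ?thesis
    using assms(6) by simp
qed

text \<open>Inverts ground instances once and for all, leaving one case per rule shape and no
  substitutions.\<close>

lemma tm_model_induct [consumes 1, case_names final left right right_end]:
  assumes "a \<in> tm_model M"
    and final: "\<And>l v r. P (conf (final M) l v r)"
    and left: "\<And>s b s' b' l v r. delta M s b = (s', b', MoveLeft)
      \<Longrightarrow> P (conf s' l v (cons_trm (symbol_trm b') r))
      \<Longrightarrow> P (conf s (cons_trm v l) (symbol_trm b) r)"
    and right: "\<And>s b s' b' l v r. delta M s b = (s', b', MoveRight)
      \<Longrightarrow> P (conf s' (cons_trm (symbol_trm b') l) v r)
      \<Longrightarrow> P (conf s l (symbol_trm b) (cons_trm v r))"
    and right_end: "\<And>s b s' b' l. delta M s b = (s', b', MoveRight)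
      \<Longrightarrow> P (conf s' (cons_trm (symbol_trm b') l) (symbol_trm (blank M)) nil_trm)
      \<Longrightarrow> P (conf s l (symbol_trm b) nil_trm)"
  shows "P a"
  using assms(1)
proof induction
  case (infer r a)
  obtain \<sigma> r0 where r: "r = subst_rule \<sigma> r0" and r0: "r0 \<in> tm_program M"
    using infer.hyps(1) by (auto simp: Ground_def)
  have a: "a \<in> subst_atom \<sigma> ` set (head r0)" and IH: "\<forall>b\<in>set (pos_body r0). P (subst_atom \<sigma> b)"
    using infer by (auto simp: r subst_rule_def)
  from r0 consider "r0 = Rule [conf (final M) (Var VarL) (Var VarV) (Var VarR)] [] []"
    | s b where "r0 \<in> transition_rules M s b"
    by (auto simp: tm_program_def)
  then show ?case
  proof cases
    case 1
    then show ?thesis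
      using a final by auto
  next
    case (2 s b)
    obtain s' b' m where \<delta>: "delta M s b = (s', b', m)"
      using prod_cases3 .
    show ?thesis
    proof (cases m)
      case MoveLeft
      then show ?thesis
        using 2 a IH left \<delta> by (auto simp: transition_rules_def)
    next
      case MoveRight
      then show ?thesis
        using 2 a IH right right_end \<delta> by (auto simp: transition_rules_def)
    qed
  qed
qed

section \<open>Configurations as atoms\<close>

text \<open>Indexing by cells rather than symbols lets both sides of the head share one encoding and
  makes a write to an unlisted cell invisible.\<close>

definition tape_list :: "(nat \<Rightarrow> 'a) \<Rightarrow> nat list \<Rightarrow> ('s, 'a) tm_trm" where
  "tape_list T is = list_trm (map (\<lambda>i. symbol_trm (T i)) is)"

text \<open>The left list is reversed so that the cell next to the head comes first. One
  configuration has many atoms, differing in the bound \<open>n\<close> of the represented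
  tape.\<close>

definition tape_atom :: "'s \<Rightarrow> (nat \<Rightarrow> 'a) \<Rightarrow> nat \<Rightarrow> nat \<Rightarrow> ('s, 'a) tm_atom" where
  "tape_atom s T h n =
    conf s (tape_list T (rev [0..<h])) (symbol_trm (T h)) (tape_list T [Suc h..<n])"

lemma tape_list_simps [simp]:
  "tape_list T [] = nil_trm"
  "tape_list T (i # is) = cons_trm (symbol_trm (T i)) (tape_list T is)"
  by (simp_all add: tape_list_def list_trm_def)

lemma tape_list_upd [simp]:
  "i \<notin> set is \<Longrightarrow> tape_list (T(i := v)) is = tape_list T is"
  by (induction "is") auto

lemma tape_list_eq_nil [simp]: "tape_list T is = nil_trm \<longleftrightarrow> is = []"
  "nil_trm = tape_list T is \<longleftrightarrow> is = []"
  by (cases "is"; simp)+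

lemma tape_atom_moved_left:
  "Suc h < n \<Longrightarrow> tape_atom s (T(Suc h := v)) h n =
    conf s (tape_list T (rev [0..<h])) (symbol_trm (T h))
      (cons_trm (symbol_trm v) (tape_list T [Suc (Suc h)..<n]))"
  by (simp add: tape_atom_def upt_conv_Cons)

text \<open>The written cell becomes the first one of the left list. The new head may lie at or
  beyond \<open>n\<close>; the right list is then empty.\<close>

lemma tape_atom_moved_right:
  "tape_atom s (T(h := v)) (Suc h) n =
    conf s (cons_trm (symbol_trm v) (tape_list T (rev [0..<h]))) (symbol_trm (T (Suc h)))
      (tape_list T [Suc (Suc h)..<n])"
  by (simp add: tape_atom_def)

section \<open>Soundness: derivable configurations are accepting\<close>

text \<open>Generalises \<open>accepts\<close> to arbitrary starting configurations, as the
  induction on derivations requires.\<close>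

definition accepting :: "('s, 'a) tm \<Rightarrow> 's \<Rightarrow> (nat \<Rightarrow> 'a) \<Rightarrow> nat \<Rightarrow> bool" where
  "accepting M s T h \<longleftrightarrow> (\<exists>T' h'. (tm_step M)\<^sup>*\<^sup>* (s, T, h) (final M, T', h'))"

lemma accepting_step:
  "tm_step M (s, T, h) (s', T', h') \<Longrightarrow> accepting M s' T' h' \<Longrightarrow> accepting M s T h"
  unfolding accepting_def by (meson converse_rtranclp_into_rtranclp)

text \<open>Each rule instance whose head encodes a configuration has a body encoding its successor.
  The bound \<open>n\<close> is generalised because the rule at the right end enlarges it.\<close>

lemma tm_model_sound:
  assumes "a \<in> tm_model M"
    and "a = tape_atom s T h n" and "h < n" and "\<And>i. i \<ge> n \<Longrightarrow> T i = blank M"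
  shows "accepting M s T h"
  using assms
proof (induction arbitrary: s T h n rule: tm_model_induct)
  case (final l v r)
  then show ?case
    by (auto simp: tape_atom_def accepting_def)
next
  case (left s0 b s' b' l v r)
  \<comment> \<open>A nonempty left list rules out the first cell, where no left move
    exists.\<close>
  then obtain k where h: "h = Suc k"
    by (cases h) (auto simp: tape_atom_def)
  have eqs: "s0 = s" "b = T h" "v = symbol_trm (T k)" "l = tape_list T (rev [0..<k])"
    "r = tape_list T [Suc h..<n]"
    using left.prems(1) by (auto simp: tape_atom_def h)
  have "accepting M s' (T(h := b')) k"
  proof (rule left.IH)
    show "conf s' l v (cons_trm (symbol_trm b') r) = tape_atom s' (T(h := b')) k n"
      using tape_atom_moved_left[of k n s' T b'] left.prems(2) by (simp add: eqs h)
  qed (use left.prems h in auto)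
  then show ?case
    using left.hyps by (auto simp: eqs h intro: accepting_step tm_step.move_left)
next
  case (right s0 b s' b' l v r)
  \<comment> \<open>The right list is nonempty, so the next cell is represented.\<close>
  then have n: "Suc h < n"
    by (cases "Suc h < n") (auto simp: tape_atom_def)
  have eqs: "s0 = s" "b = T h" "l = tape_list T (rev [0..<h])" "v = symbol_trm (T (Suc h))"
    "r = tape_list T [Suc (Suc h)..<n]"
    using right.prems(1) n by (auto simp: tape_atom_def upt_conv_Cons)
  have "accepting M s' (T(h := b')) (Suc h)"
  proof (rule right.IH)
    show "conf s' (cons_trm (symbol_trm b') l) v r = tape_atom s' (T(h := b')) (Suc h) n"
      by (simp add: tape_atom_moved_right eqs)
  qed (use right.prems n in auto)
  then show ?case
    using right.hyps by (auto simp: eqs intro: accepting_step tm_step.move_right)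
next
  case (right_end s0 b s' b' l)
  then have n: "n = Suc h"
    by (auto simp: tape_atom_def)
  have eqs: "s0 = s" "b = T h" "l = tape_list T (rev [0..<h])"
    using right_end.prems(1) by (auto simp: tape_atom_def)
  have "accepting M s' (T(h := b')) (Suc h)"
  proof (rule right_end.IH)
    \<comment> \<open>The new head is at cell \<open>n\<close>, blank by assumption; the bound
      \<open>Suc n\<close> keeps the head below it.\<close>
    show "conf s' (cons_trm (symbol_trm b') l) (symbol_trm (blank M)) nil_trm =
        tape_atom s' (T(h := b')) (Suc h) (Suc n)"
      using right_end.prems(3)[of n] by (simp add: tape_atom_moved_right eqs n)
  qed (use right_end.prems n in auto)
  then show ?case
    using right_end.hyps by (auto simp: eqs intro: accepting_step tm_step.move_right)
qed

section \<open>Tape terms in the Herbrand universe\<close>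

lemma constant_in_universe: "(f, 0) \<in> program_funs P \<Longrightarrow> Fun f [] \<in> herbrand_universe P"
  by (auto simp: herbrand_universe_def intro: ground_terms.intros)

lemma program_funs_conf:
  assumes "Rule [conf s l v r] bs [] \<in> P"
  shows "trm_funs l \<union> trm_funs v \<union> trm_funs r \<subseteq> program_funs P"
proof -
  have "conf s l v r \<in> program_atoms P"
    using assms by (force simp: program_atoms_def rule_atoms_def)
  then show ?thesis
    by (force simp: program_funs_def conf_def)
qed

text \<open>The initial state is not final, so it has a rule for \<open>v\<close>; in either
  direction some rule head contains both \<open>v\<close> and a list constructor.\<close>

lemma tm_program_funs:
  assumes "turing_machine M" "v \<in> alphabet M"
  shows "{(ConsSym, 2), (SymbolConst v, 0)} \<subseteq> program_funs (tm_program M)"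
proof -
  have init: "init M \<in> states M" "init M \<noteq> final M"
    using assms(1) by (auto simp: turing_machine_def)
  note rules = transition_rules_in_program[OF init assms(2)]
  obtain s' v' m where \<delta>: "delta M (init M) v = (s', v', m)"
    using prod_cases3 .
  show ?thesis
  proof (cases m)
    case MoveLeft
    with rules \<delta> have "Rule [conf (init M) (cons_trm (Var VarV) (Var VarL)) (symbol_trm v) (Var VarR)]
        [conf s' (Var VarL) (Var VarV) (cons_trm (symbol_trm v') (Var VarR))] [] \<in> tm_program M"
      by (simp add: transition_rules_def)
    from program_funs_conf[OF this] show ?thesis
      by (simp add: numeral_2_eq_2)
  next
    case MoveRight
    with rules \<delta> have "Rule [conf (init M) (Var VarL) (symbol_trm v) (cons_trm (Var VarV) (Var VarR))]
        [conf s' (cons_trm (symbol_trm v') (Var VarL)) (Var VarV) (Var VarR)] [] \<in> tm_program M"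
      by (simp add: transition_rules_def)
    from program_funs_conf[OF this] show ?thesis
      by (simp add: numeral_2_eq_2)
  qed
qed

text \<open>Among the rule shapes only the one for a right move at the end of the represented tape
  mentions the empty list.\<close>

lemma nil_in_universe:
  assumes "s \<in> states M" "s \<noteq> final M" "v \<in> alphabet M" "delta M s v = (s', v', MoveRight)"
  shows "nil_trm \<in> tm_universe M"
proof -
  have "Rule [conf s (Var VarL) (symbol_trm v) nil_trm]
      [conf s' (cons_trm (symbol_trm v') (Var VarL)) (symbol_trm (blank M)) nil_trm] [] \<in> tm_program M"
    using transition_rules_in_program[OF assms(1-3)] by (simp add: transition_rules_def assms(4))
  from program_funs_conf[OF this] show ?thesis
    by (simp add: constant_in_universe)
qed

lemma symbol_in_universe:
  "turing_machine M \<Longrightarrow> v \<in> alphabet M \<Longrightarrow> symbol_trm v \<in> tm_universe M"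
  using tm_program_funs[of M v] by (simp add: constant_in_universe)

lemma tape_list_in_universe:
  assumes M: "turing_machine M" and "nil_trm \<in> tm_universe M" and T: "\<And>i. T i \<in> alphabet M"
  shows "tape_list T is \<in> tm_universe M"
proof (induction "is")
  case (Cons i "is")
  have "(ConsSym, 2) \<in> program_funs (tm_program M)"
    using tm_program_funs[OF M T[of i]] by simp
  with Cons symbol_in_universe[OF M T, of i] show ?case
    by (auto simp: herbrand_universe_def numeral_2_eq_2 intro!: ground_terms.intros)
qed (use assms in simp)

section \<open>Completeness: accepting configurations are derivable\<close>

text \<open>Induction from the end of the run back to its start, one rule per step. States and
  symbols stay within the machine, so the rule exists and its instance is ground.\<close>

lemma tm_model_complete:
  assumes M: "turing_machine M" and nil: "nil_trm \<in> tm_universe M"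
    and "(tm_step M)\<^sup>*\<^sup>* (s, T, h) (final M, T', h')"
    and "s \<in> states M" "\<And>i. T i \<in> alphabet M" "h < n" "\<And>i. i \<ge> n \<Longrightarrow> T i = blank M"
  shows "tape_atom s T h n \<in> tm_model M"
  using assms(3-)
proof (induction "(s, T, h)" arbitrary: s T h n rule: converse_rtranclp_induct)
  case base
  then show ?case
    by (simp add: tape_atom_def tm_model_final tape_list_in_universe[OF M nil]
        symbol_in_universe[OF M])
next
  case (step c)
  have U: "tape_list T is \<in> tm_universe M" "symbol_trm (T i) \<in> tm_universe M" for "is" i
    using tape_list_in_universe[OF M nil] symbol_in_universe[OF M] step.prems(2) by auto
  show ?case
  \<comment> \<open>A run may pass through the final state and continue, but no transition rules
    exist there; the fact for \<open>final M\<close> closes this case.\<close>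
  proof (cases "s = final M")
    case True
    then show ?thesis
      by (simp add: tape_atom_def tm_model_final U)
  next
    case False
    note hd_rule = step.prems(1) False step.prems(2)
    have "delta M s (T h) \<in> states M \<times> alphabet M \<times> UNIV"
      using M step.prems(1) step.prems(2)[of h] by (simp add: turing_machine_def)
    then have \<delta>_closed: "s' \<in> states M" "v' \<in> alphabet M" if "delta M s (T h) = (s', v', m)" for s' v' m
      using that by simp_all
    have upd_alphabet: "(T(h := v)) i \<in> alphabet M" if "v \<in> alphabet M" for v i
      using that step.prems(2)[of i] by simp
    have upd_blank: "(T(h := v)) i = blank M" if "n \<le> i" for v i
      using that step.prems(3) step.prems(4)[OF that] by simp
    from step.hyps(1) show ?thesis
    proof cases
      case (move_right s' v')
      note closed = \<delta>_closed[OF move_right(2)]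
      \<comment> \<open>The bound is left open: \<open>n\<close> itself works while the next cell is
        represented, \<open>Suc n\<close> at the right end.\<close>
      have IH: "tape_atom s' (T(h := v')) (Suc h) k \<in> tm_model M" if "k \<ge> n" "Suc h < k" for k
        by (rule step.hyps(3)[OF move_right(1) closed(1) upd_alphabet[OF closed(2)] that(2) upd_blank])
          (use that(1) in simp)
      show ?thesis
      proof (cases "Suc h < n")
        case True
        have "conf s (tape_list T (rev [0..<h])) (symbol_trm (T h))
            (cons_trm (symbol_trm (T (Suc h))) (tape_list T [Suc (Suc h)..<n])) \<in> tm_model M"
          by (rule tm_model_right[OF hd_rule move_right(2) U(1) U(2) U(1)])
            (rule IH[OF order_refl True, unfolded tape_atom_moved_right])
        then show ?thesis
          using True by (simp add: tape_atom_def upt_conv_Cons)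
      next
        case False
        then have n: "n = Suc h"
          using step.prems(3) by simp
        \<comment> \<open>With bound \<open>Suc n\<close> the successor scans the blank cell
          \<open>n\<close> and has an empty right list, just as the body of the end rule
          demands.\<close>
        have "conf s (tape_list T (rev [0..<h])) (symbol_trm (T h)) nil_trm \<in> tm_model M"
          by (rule tm_model_right_end[OF hd_rule move_right(2) U(1)])
            (use IH[of "Suc n"] step.prems(4)[of n] n in \<open>simp add: tape_atom_moved_right\<close>)
        then show ?thesis
          by (simp add: tape_atom_def n)
      qed
    next
      case (move_left k s' v')
      note \<delta> = move_left(3)[folded move_left(1)]
      note closed = \<delta>_closed[OF \<delta>]
      \<comment> \<open>A left move keeps the bound: the written cell \<open>Suc k\<close> lies
        below \<open>n\<close> and becomes the first one of the right list.\<close>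
      have k: "k < n" "Suc k < n"
        using step.prems(3) move_left(1) by simp_all
      have "tape_atom s' (T(h := v')) k n \<in> tm_model M"
        by (rule step.hyps(3)[OF move_left(2)[folded move_left(1)] closed(1)
              upd_alphabet[OF closed(2)] k(1) upd_blank])
      then have "conf s (cons_trm (symbol_trm (T k)) (tape_list T (rev [0..<k]))) (symbol_trm (T h))
          (tape_list T [Suc h..<n]) \<in> tm_model M"
        unfolding move_left(1) tape_atom_moved_left[OF k(2)]
        by (rule tm_model_left[OF hd_rule[unfolded move_left(1)] \<delta>[unfolded move_left(1)] U(1) U(2) U(1)])
      then show ?thesis
        by (simp add: tape_atom_def move_left(1))
    qed
  qed
qed

section \<open>The query and the initial configuration\<close>

text \<open>The maximum with 1 keeps the head cell 0 below the bound for the empty input, where that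
  cell is blank.\<close>

lemma tm_query_eq_tape_atom:
  fixes M :: "('s, 'a) tm"
  assumes "T = (\<lambda>i. if i < length x then x ! i else blank M)"
  shows "tm_query M x = tape_atom (init M) T 0 (max 1 (length x))"
proof (cases x)
  case (Cons y ys)
  have "map (\<lambda>i. symbol_trm (T i)) [Suc 0..<length x] = (map symbol_trm ys :: ('s, 'a) tm_trm list)"
    by (rule nth_equalityI) (simp_all add: assms Cons del: upt_Suc)
  then have "tape_list T [Suc 0..<length x] = (list_trm (map symbol_trm ys) :: ('s, 'a) tm_trm)"
    unfolding tape_list_def by (rule arg_cong)
  moreover have "T 0 = y" "max 1 (length x) = length x"
    by (simp_all add: assms Cons)
  ultimately show ?thesis
    by (simp add: tape_atom_def tm_query_def Cons del: upt_Suc)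
qed (simp add: assms tm_query_def tape_atom_def)

text \<open>As the initial state is not final, an accepting run has a first step, and at cell 0 that
  step moves right.\<close>

lemma accepting_nil_in_universe:
  assumes M: "turing_machine M" and acc: "accepting M (init M) T 0" and T: "T 0 \<in> alphabet M"
  shows "nil_trm \<in> tm_universe M"
proof -
  have init: "init M \<in> states M" "init M \<noteq> final M"
    using M by (auto simp: turing_machine_def)
  from acc obtain c where "tm_step M (init M, T, 0) c"
    unfolding accepting_def using init(2) by (auto elim: converse_rtranclpE)
  then show ?thesis
    by cases (use nil_in_universe[OF init T] in auto)
qed

theorem theorem6:
  fixes M :: "('s, 'a) tm" and x :: "'a list"
  assumes "turing_machine M"
    and "set x \<subseteq> alphabet M - {blank M}"
  shows "(bravely_entails (tm_program M) (tm_query M x) \<longleftrightarrow> accepts M x) \<and>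
         (cautiously_entails (tm_program M) (tm_query M x) \<longleftrightarrow> accepts M x)"
proof -
  define T where "T = (\<lambda>i. if i < length x then x ! i else blank M)"
  have T: "T i \<in> alphabet M" for i
    using assms nth_mem[of i x] by (cases "i < length x") (auto simp: T_def turing_machine_def simp del: nth_mem)
  have query: "tm_query M x = tape_atom (init M) T 0 (max 1 (length x))"
    using T_def by (rule tm_query_eq_tape_atom)
  have blank: "T i = blank M" if "i \<ge> max 1 (length x)" for i
    using that by (simp add: T_def)
  have acc: "accepts M x \<longleftrightarrow> accepting M (init M) T 0"
    by (simp add: accepts_def accepting_def initial_config_def T_def)
  have "tm_query M x \<in> tm_model M \<longleftrightarrow> accepting M (init M) T 0"
  proof
    assume "tm_query M x \<in> tm_model M"
    then show "accepting M (init M) T 0"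
      using query by (rule tm_model_sound) (use blank in auto)
  next
    assume *: "accepting M (init M) T 0"
    then obtain T' h' where "(tm_step M)\<^sup>*\<^sup>* (init M, T, 0) (final M, T', h')"
      by (auto simp: accepting_def)
    \<comment> \<open>The accepting run itself puts the empty list into the universe, which
      completeness presupposes.\<close>
    from tm_model_complete[OF assms(1) accepting_nil_in_universe[OF assms(1) * T] this _ T _ blank]
    show "tm_query M x \<in> tm_model M"
      using assms(1) by (simp add: query turing_machine_def)
  qed
  then show ?thesis
    using entails_definite[of "tm_program M"] definite_tm_program acc by blast
qed

end
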